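(* For every integer $N\ge 1$, the admissible orthogonal matrices for the alternating memory-$N$ game are exactly $J_N^1, J_N^2, J_N^3, J_N^4$.
   Context: Fix $N\ge1$. States are words $i_1i_2\ldots i_{2N}$ with letters in $\{C,D\}$, in lexicographic order with $C$ before $D$; there are $2^{2N}$ of them. Strategies are vectors $\mathbf p=(p_{i_1\ldots i_{2N}})$ and $\mathbf q=(q_{j_1\ldots j_{2N}})$ in $[0,1]^{2^{2N}}$, indexed by such words. The transition matrix $\mathbf M_N(\mathbf p,\mathbf q)$ of the alternating memory-$N$ game is the $2^{2N}\times 2^{2N}$ row-stochastic matrix whose row indexed by $i_1i_2\ldots i_{2N}$ has only the following four possibly nonzero entries, in the columns indicated: column $i_3\ldots i_{2N}CC$: $p_{i_1\ldots i_{2N}}\,q_{i_2\ldots i_{2N}C}$; column $i_3\ldots i_{2N}CD$: $p_{i_1\ldots i_{2N}}\,(1-q_{i_2\ldots i_{2N}C})$; column $i_3\ldots i_{2N}DC$: $(1-p_{i_1\ldots i_{2N}})\,q_{i_2\ldots i_{2N}D}$; column $i_3\ldots i_{2N}DD$: $(1-p_{i_1\ldots i_{2N}})\,(1-q_{i_2\ldots i_{2N}D})$. (For $N=1$ the word $i_3\ldots i_{2N}$ is empty.) An invariant distribution of $\mathbf M_N(\mathbf p,\mathbf q)$ is a probability vector $\nu$ with $\nu^T\mathbf M_N(\mathbf p,\mathbf q)=\nu^T$. An orthogonal real $2^{2N}\times2^{2N}$ matrix $\mathbf O$ acts on the elements of the game by $\nu\mapsto \mathbf O\nu$, $\mathbf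 M_N\mapsto \mathbf O\mathbf M_N\mathbf O^T$, $\mathbf f_N\mapsto\mathbf O\mathbf f_N$ (invariant distribution, transition matrix, payoff vector). It is called admissible if the transformed data are again those of an alternating memory-$N$ game, i.e. if for all $\mathbf p,\mathbf q\in[0,1]^{2^{2N}}$ there exist $\mathbf p',\mathbf q'\in[0,1]^{2^{2N}}$ with $\mathbf O\mathbf M_N(\mathbf p,\mathbf q)\mathbf O^T=\mathbf M_N(\mathbf p',\mathbf q')$, and for every invariant distribution $\nu$ of $\mathbf M_N(\mathbf p,\mathbf q)$ the vector $\mathbf O\nu$ is an invariant distribution (in particular a probability vector) of $\mathbf M_N(\mathbf p',\mathbf q')$. The matrices $J_N^i$ are defined recursively. $J_1^1$ is the $4\times4$ identity, and $$J_1^2=\begin{pmatrix}0&1&0&0\\1&0&0&0\\0&0&0&1\\0&0&1&0\end{pmatrix},\quad J_1^3=\begin{pmatrix}0&0&1&0\\0&0&0&1\\1&0&0&0\\0&1&0&0\end{pmatrix},\quad J_1^4=\begin{pmatrix}0&0&0&1\\0&0&1&0\\0&1&0&0\\1&0&0&0\end{pmatrix}.$$ For $N\ge2$, $J_N^i$ is obtained from $J_1^i$ by replacing each entry $0$ by the $2^{2(N-1)}\times2^{2(N-1)}$ zero matrix and each entry $1$ by $J_{N-1}^i$ (that is, $J_N^i=J_1^i\otimes J_{N-1}^i$). *)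

theory Defs
  imports Complex_Main "HOL-Library.FuncSet" "Jordan_Normal_Form.Matrix"
begin

datatype letter = C | D

(* Lexicographic enumeration of the words of length n (C before D).
   Vectors and matrices are indexed by position in this enumeration, starting from 0. *)
fun words :: "nat \<Rightarrow> letter list list" where
  "words 0 = [[]]"
| "words (Suc n) = map (Cons C) (words n) @ map (Cons D) (words n)"

lemma length_words [simp]: "length (words n) = 2 ^ n"
  by (induction n) auto

lemma set_words: "set (words n) = {w. length w = n}"
proof (induction n)
  case (Suc n)
  have "w \<in> set (words (Suc n)) \<longleftrightarrow> length w = Suc n" for w
    using Suc by (cases w; cases "hd w") auto
  then show ?case by blast
qed auto

lemma sorted_words: "sorted_wrt (\<lambda>v w. (v, w) \<in> lexord {(C, D)}) (words n)"
  by (induction n) (auto simp: sorted_wrt_append sorted_wrt_map)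

definition strategies :: "nat \<Rightarrow> (letter list \<Rightarrow> real) set" where
  "strategies N = {w. length w = 2 * N} \<rightarrow>\<^sub>E {0..1}"

(* The probability of playing a given letter when C is played with probability x. *)
definition play :: "real \<Rightarrow> letter \<Rightarrow> real" where
  "play x a = (case a of C \<Rightarrow> x | D \<Rightarrow> 1 - x)"

(* Entry in the row of the word v = i_1 ... i_2N and the column of the word w:
   nonzero only if w = i_3 ... i_2N a b. The second player answers the word
   i_2 ... i_2N a, which already contains the new letter a of the first player. *)
definition transition_entry ::
  "(letter list \<Rightarrow> real) \<Rightarrow> (letter list \<Rightarrow> real) \<Rightarrow> letter list \<Rightarrow> letter list \<Rightarrow> real" where
  "transition_entry p q v w =
     (let a = last (butlast w); b = last w in
      if w = drop 2 v @ [a, b] then play (p v) a * play (q (tl v @ [a])) b else 0)"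

definition transition_mat ::
  "nat \<Rightarrow> (letter list \<Rightarrow> real) \<Rightarrow> (letter list \<Rightarrow> real) \<Rightarrow> real mat" where
  "transition_mat N p q =
     mat (2 ^ (2 * N)) (2 ^ (2 * N))
       (\<lambda>(r, c). transition_entry p q (words (2 * N) ! r) (words (2 * N) ! c))"

definition probability_vec :: "nat \<Rightarrow> real vec \<Rightarrow> bool" where
  "probability_vec n \<nu> \<longleftrightarrow>
     \<nu> \<in> carrier_vec n \<and> (\<forall>i<n. 0 \<le> \<nu> $ i) \<and> (\<Sum>i<n. \<nu> $ i) = 1"

(* The row-vector equation \<nu>^T M = \<nu>^T is written in transposed form. *)
definition invariant_distribution :: "nat \<Rightarrow> real mat \<Rightarrow> real vec \<Rightarrow> bool" where
  "invariant_distribution n M \<nu> \<longleftrightarrow> probability_vec n \<nu> \<and> transpose_mat M *\<^sub>v \<nu> = \<nu>"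

(* Orthogonal in the usual sense O O^T = O^T O = 1. The library's orthogonal_mat only asks
   the columns to be nonzero and pairwise orthogonal, not normalised. *)
definition real_orthogonal :: "nat \<Rightarrow> real mat \<Rightarrow> bool" where
  "real_orthogonal n Q \<longleftrightarrow>
     Q \<in> carrier_mat n n \<and> Q * transpose_mat Q = 1\<^sub>m n \<and> transpose_mat Q * Q = 1\<^sub>m n"

(* The payoff vector f goes to Q f, which can be any vector: it imposes no condition. *)
definition admissible :: "nat \<Rightarrow> real mat \<Rightarrow> bool" where
  "admissible N Q \<longleftrightarrow>
     (\<forall>p \<in> strategies N. \<forall>q \<in> strategies N.
        \<exists>p' \<in> strategies N. \<exists>q' \<in> strategies N.
          Q * transition_mat N p q * transpose_mat Q = transition_mat N p' q' \<and>
          (\<forall>\<nu>. invariant_distribution (2 ^ (2 * N)) (transition_mat N p q) \<nu> \<longrightarrow>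
                invariant_distribution (2 ^ (2 * N)) (transition_mat N p' q') (Q *\<^sub>v \<nu>)))"

definition kronecker_mat :: "real mat \<Rightarrow> real mat \<Rightarrow> real mat" where
  "kronecker_mat A B =
     mat (dim_row A * dim_row B) (dim_col A * dim_col B)
       (\<lambda>(r, c). A $$ (r div dim_row B, c div dim_col B) *
                 B $$ (r mod dim_row B, c mod dim_col B))"

(* Only the indices i = 1, 2, 3, 4 are meaningful. *)
definition J1 :: "nat \<Rightarrow> real mat" where
  "J1 i =
     (if i = 1 then 1\<^sub>m 4
      else if i = 2 then
        mat_of_rows_list 4 [[0, 1, 0, 0], [1, 0, 0, 0], [0, 0, 0, 1], [0, 0, 1, 0]]
      else if i = 3 then
        mat_of_rows_list 4 [[0, 0, 1, 0], [0, 0, 0, 1], [1, 0, 0, 0], [0, 1, 0, 0]]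
      else
        mat_of_rows_list 4 [[0, 0, 0, 1], [0, 0, 1, 0], [0, 1, 0, 0], [1, 0, 0, 0]])"

(* J N i is J_N^i; the value at N = 0 is a dummy. *)
fun J :: "nat \<Rightarrow> nat \<Rightarrow> real mat" where
  "J 0 i = 1\<^sub>m 1"
| "J (Suc 0) i = J1 i"
| "J (Suc (Suc n)) i = kronecker_mat (J1 i) (J (Suc n) i)"

end

theory Submission
  imports Defs
begin

text \<open>
  Pure strategies and the point mass at \<open>C\<dots>C\<close> show that an admissible orthogonal \<open>Q\<close> has all column
  sums (hence row sums) \<open>1\<close>. Altering a pure strategy only at words with a fixed suffix changes
  the transition matrix by a rank one matrix, whose image under \<open>Q\<close> must be supported on legal moves;
  so \<open>Q\<close> permutes the blocks of words with a common suffix, its entries occur as transition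
  probabilities and are nonnegative, and \<open>Q\<close> is the matrix of a permutation \<open>\<phi>\<close> of the words.

  This \<open>\<phi>\<close> is an automorphism of the graph of legal moves, a de Bruijn graph over the alphabet of
  letter pairs, so it acts by one permutation of the four pairs applied to every pair of a word. The
  second player ignores the first letter of a state and sees the new letter of the first player.
  This forces the permutation to act on the two components of a pair separately, which leaves
  four possibilities.
\<close>

subsection \<open>Automorphisms of the move graph\<close>

definition flip :: "bool \<Rightarrow> letter \<Rightarrow> letter" where
  "flip s a = (if s then (case a of C \<Rightarrow> D | D \<Rightarrow> C) else a)"

lemma flip_flip [simp]: "flip s (flip s a) = a"
  by (cases a) (auto simp: flip_def)

text \<open>The flags alternate along the word because the players' letters do. Dropping one letter
  swaps them, which matches the change from the first player's view of a word to the
  second's.\<close>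

fun flip_word :: "bool \<Rightarrow> bool \<Rightarrow> letter list \<Rightarrow> letter list" where
  "flip_word s t [] = []"
| "flip_word s t (a # w) = flip s a # flip_word t s w"

lemma length_flip_word [simp]: "length (flip_word s t w) = length w"
  by (induction s t w rule: flip_word.induct) auto

lemma flip_word_flip_word [simp]: "flip_word s t (flip_word s t w) = w"
  by (induction s t w rule: flip_word.induct) auto

lemma flip_word_eq_iff: "flip_word s t v = w \<longleftrightarrow> v = flip_word s t w"
  by auto

lemma tl_flip_word: "tl (flip_word s t w) = flip_word t s (tl w)"
  by (cases w) auto

lemma drop2_flip_word: "drop 2 (flip_word s t w) = flip_word s t (drop 2 w)"
  by (cases w; cases "tl w") auto

lemma flip_word_append:
  "flip_word s t (v @ w) = flip_word s t v @ (if even (length v) then flip_word s t w else flip_word t s w)"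
  by (induction s t v rule: flip_word.induct) auto

lemma nth_flip_word: "i < length w \<Longrightarrow> flip_word s t w ! i = flip (if even i then s else t) (w ! i)"
  by (induction s t w arbitrary: i rule: flip_word.induct) (auto simp: nth_Cons split: nat.split)

section \<open>Pure moves and their symmetries\<close>

definition step :: "(letter list \<Rightarrow> letter) \<Rightarrow> (letter list \<Rightarrow> letter) \<Rightarrow> letter list \<Rightarrow> letter list" where
  "step P R v = drop 2 v @ [P v, R (tl v @ [P v])]"

lemma length_step: "2 \<le> length v \<Longrightarrow> length (step P R v) = length v"
  by (simp add: step_def)

text \<open>What survives of admissibility once the matrix is known to be a permutation: conjugation
  carries pure play to pure play.\<close>

locale step_symmetry =
  fixes N :: nat and \<phi> :: "letter list \<Rightarrow> letter list"
  assumes N_pos: "1 \<le> N"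
    and length_\<phi>: "length w = 2 * N \<Longrightarrow> length (\<phi> w) = 2 * N"
    and inj_\<phi>: "inj_on \<phi> {w. length w = 2 * N}"
    and step_\<phi>: "\<exists>P' R'. \<forall>v. length v = 2 * N \<longrightarrow> \<phi> (step P R v) = step P' R' (\<phi> v)"
begin

text \<open>The constant strategies \<open>a\<close> and \<open>b\<close> make
  \<open>drop 2 v @ [a, b]\<close> the successor of \<open>v\<close>, so every legal move is covered
  by \<open>step_\<phi>\<close>.\<close>

lemma edge_\<phi>:
  assumes "length v = 2 * N"
  shows "take (2 * N - 2) (\<phi> (drop 2 v @ [a, b])) = drop 2 (\<phi> v)"
proof -
  obtain P' R' where "\<phi> (step (\<lambda>_. a) (\<lambda>_. b) v) = step P' R' (\<phi> v)"
    using step_\<phi>[of "\<lambda>_. a" "\<lambda>_. b"] assms by blast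
  then show ?thesis
    using assms length_\<phi>[OF assms] by (simp add: step_def)
qed

text \<open>The overlap condition says that \<open>w\<close> can be reached from \<open>v\<close> by
  \<open>k\<close> legal moves. Induction on \<open>k\<close>, applying \<open>edge_\<phi>\<close>
  to the first move.\<close>

lemma walk_\<phi>:
  assumes "k \<le> N" "length v = 2 * N" "length w = 2 * N"
    and "drop (2 * k) v = take (2 * N - 2 * k) w"
  shows "drop (2 * k) (\<phi> v) = take (2 * N - 2 * k) (\<phi> w)"
  using assms
proof (induction k arbitrary: v)
  case 0
  then show ?case using length_\<phi> by simp
next
  case (Suc k)
  define m where "m = 2 * N - 2 * Suc k"
  have m: "2 * N - 2 * k = m + 2" "m + 2 \<le> 2 * N" "2 * N - 2 = m + 2 * k"
    using Suc.prems(1) by (auto simp: m_def)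
  \<comment> \<open>The pair that the first of the \<open>Suc k\<close> moves has to append: it
    follows the overlap of length \<open>m\<close> in \<open>w\<close>.\<close>
  define a b where "a = w ! m" and "b = w ! Suc m"
  have ab: "take (m + 2) w = take m w @ [a, b]"
    using m(2) Suc.prems(3) by (simp add: a_def b_def take_Suc_conv_app_nth)
  let ?u = "drop 2 v @ [a, b]"
  have *: "drop (2 * Suc k) v = take m w"
    using Suc.prems(4) by (simp add: m_def)
  have "drop (2 * k) ?u = drop (2 * Suc k) v @ [a, b]"
    using Suc.prems(1,2) by (simp add: drop_append)
  then have "drop (2 * k) ?u = take (2 * N - 2 * k) w"
    using ab m(1) * by simp
  then have IH: "drop (2 * k) (\<phi> ?u) = take (m + 2) (\<phi> w)"
    using Suc.IH[of ?u] Suc.prems m(1) by simp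
  have "drop (2 * Suc k) (\<phi> v) = drop (2 * k) (drop 2 (\<phi> v))"
    by (simp add: add.commute)
  also have "\<dots> = drop (2 * k) (take (m + 2 * k) (\<phi> ?u))"
    using edge_\<phi>[of v a b] Suc.prems(2) m(3) by simp
  also have "\<dots> = take m (drop (2 * k) (\<phi> ?u))"
    by (simp add: drop_take)
  also have "\<dots> = take m (\<phi> w)"
    by (simp add: IH)
  finally show ?case by (simp add: m_def)
qed

definition pad :: "letter \<Rightarrow> letter \<Rightarrow> letter list" where
  "pad a b = a # b # replicate (2 * N - 2) C"

lemma length_pad [simp]: "length (pad a b) = 2 * N"
  using N_pos by (simp add: pad_def)

lemma hd_pad [simp]: "hd (pad a b) = a"
  by (simp add: pad_def)

lemma tl_pad [simp]: "tl (pad a b) = b # replicate (2 * N - 2) C"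
  by (simp add: pad_def)

text \<open>A word ending in the common first pair reaches both \<open>v\<close> and
  \<open>w\<close> in \<open>N - 1\<close> moves, so the last pair of its image is the first pair of
  both images.\<close>

lemma take2_\<phi>:
  assumes "length v = 2 * N" "length w = 2 * N" "take 2 v = take 2 w"
  shows "take 2 (\<phi> v) = take 2 (\<phi> w)"
proof -
  let ?u = "replicate (2 * N - 2) C @ take 2 w"
  have u: "length ?u = 2 * N" using N_pos assms by simp
  have N: "2 * (N - 1) = 2 * N - 2" "2 * N - (2 * N - 2) = 2" using N_pos by auto
  have "drop (2 * (N - 1)) (\<phi> ?u) = take 2 (\<phi> x)" if "x \<in> {v, w}" for x
    using walk_\<phi>[of "N - 1" ?u x] u assms that N by auto
  then show ?thesis by (metis insert_iff)
qed

text \<open>Appending \<open>C\<close> in \<open>k\<close> moves brings the pair in question to the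
  front. The images overlap accordingly, and \<open>take2_\<phi>\<close> allows replacing the rest
  of the word by padding.\<close>

lemma block_\<phi>:
  assumes w: "length w = 2 * N" and k: "k < N"
  shows "take 2 (drop (2 * k) (\<phi> w)) = take 2 (\<phi> (pad (w ! (2 * k)) (w ! Suc (2 * k))))"
proof -
  let ?x = "drop (2 * k) w @ replicate (2 * k) C"
  have x: "length ?x = 2 * N" using w k by simp
  have "drop (2 * k) w = w ! (2 * k) # w ! Suc (2 * k) # drop (2 * k + 2) w"
    using w k by (simp add: Cons_nth_drop_Suc)
  then have tx: "take 2 ?x = take 2 (pad (w ! (2 * k)) (w ! Suc (2 * k)))"
    by (simp add: pad_def)
  have "drop (2 * k) (\<phi> w) = take (2 * N - 2 * k) (\<phi> ?x)"
    using walk_\<phi>[of k w ?x] w k x by simp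
  then have "take 2 (drop (2 * k) (\<phi> w)) = take 2 (\<phi> ?x)"
    using k by (simp add: min_absorb1)
  then show ?thesis using take2_\<phi>[OF x length_pad tx] by simp
qed

section \<open>The induced permutation of letter pairs\<close>

definition first :: "letter \<Rightarrow> letter \<Rightarrow> letter" where
  "first a b = \<phi> (pad a b) ! 0"

definition second :: "letter \<Rightarrow> letter \<Rightarrow> letter" where
  "second a b = \<phi> (pad a b) ! 1"

lemma nth_\<phi>:
  assumes w: "length w = 2 * N" and k: "k < N"
  shows "\<phi> w ! (2 * k) = first (w ! (2 * k)) (w ! Suc (2 * k))"
    and "\<phi> w ! Suc (2 * k) = second (w ! (2 * k)) (w ! Suc (2 * k))"
proof -
  have *: "\<phi> w ! (2 * k + i) = \<phi> (pad (w ! (2 * k)) (w ! Suc (2 * k))) ! i" if "i < 2" for i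
    using arg_cong[OF block_\<phi>[OF w k], of "\<lambda>x. x ! i"] that w k length_\<phi>[OF w] by simp
  show "\<phi> w ! (2 * k) = first (w ! (2 * k)) (w ! Suc (2 * k))"
    using *[of 0] by (simp add: first_def)
  show "\<phi> w ! Suc (2 * k) = second (w ! (2 * k)) (w ! Suc (2 * k))"
    using *[of 1] by (simp add: second_def)
qed

lemma \<phi>_eqI:
  assumes v: "length v = 2 * N" and x: "length x = 2 * N"
    and "\<And>k. k < N \<Longrightarrow> x ! (2 * k) = first (v ! (2 * k)) (v ! Suc (2 * k))"
    and "\<And>k. k < N \<Longrightarrow> x ! Suc (2 * k) = second (v ! (2 * k)) (v ! Suc (2 * k))"
  shows "\<phi> v = x"
proof (rule nth_equalityI)
  show "length (\<phi> v) = length x" using length_\<phi>[OF v] x by simp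
  fix i assume i: "i < length (\<phi> v)"
  then have i': "i div 2 < N" using length_\<phi>[OF v] by auto
  show "\<phi> v ! i = x ! i"
  proof (cases "even i")
    case True
    then have "i = 2 * (i div 2)" by simp
    then show ?thesis using nth_\<phi>(1)[OF v i'] assms(3)[OF i'] by metis
  next
    case False
    then have "i = Suc (2 * (i div 2))" by presburger
    then show ?thesis using nth_\<phi>(2)[OF v i'] assms(4)[OF i'] by metis
  qed
qed

text \<open>Padded words differ only in their first pair, so two pairs with the same image would
  contradict injectivity of \<open>\<phi>\<close>.\<close>

lemma first_second_inj:
  assumes "first a b = first c d" "second a b = second c d"
  shows "a = c \<and> b = d"
proof -
  have "\<phi> (pad a b) = \<phi> (pad c d)"
  proof (rule \<phi>_eqI)
    fix k assume k: "k < N"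
    have "first (pad c d ! (2 * k)) (pad c d ! Suc (2 * k)) = first (pad a b ! (2 * k)) (pad a b ! Suc (2 * k))
        \<and> second (pad c d ! (2 * k)) (pad c d ! Suc (2 * k)) = second (pad a b ! (2 * k)) (pad a b ! Suc (2 * k))"
      using assms k by (cases k) (auto simp: pad_def)
    then show "\<phi> (pad c d) ! (2 * k) = first (pad a b ! (2 * k)) (pad a b ! Suc (2 * k))"
      "\<phi> (pad c d) ! Suc (2 * k) = second (pad a b ! (2 * k)) (pad a b ! Suc (2 * k))"
      using nth_\<phi>[of "pad c d" k] k by auto
  qed (auto simp: length_\<phi>)
  then have "pad a b = pad c d"
    using inj_\<phi> by (simp add: inj_on_def)
  then show ?thesis by (simp add: pad_def)
qed

text \<open>The padded words agree after the first pair, and \<open>tl\<close> removes the only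
  letter of the images in which \<open>first\<close> could still differ.\<close>

lemma tl_\<phi>_pad:
  assumes "second a b = second c d"
  shows "tl (\<phi> (pad a b)) = tl (\<phi> (pad c d))"
proof (rule nth_equalityI)
  fix i assume "i < length (tl (\<phi> (pad a b)))"
  then have i: "Suc i < 2 * N" by (simp add: length_\<phi>)
  have "\<phi> (pad a b) ! Suc i = \<phi> (pad c d) ! Suc i"
  proof (cases "even (Suc i)")
    case True
    define k where "k = Suc i div 2"
    have k: "Suc i = 2 * k" using True by (simp add: k_def)
    then have "k < N" "k \<noteq> 0" using i by auto
    with k show ?thesis using nth_\<phi>(1)[of "pad a b" k] nth_\<phi>(1)[of "pad c d" k]
      by (cases k) (auto simp: pad_def)
  next
    case False
    define k where "k = Suc i div 2"
    have k: "Suc i = Suc (2 * k)" using False by (simp add: k_def)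
    then have "k < N" using i by auto
    with k show ?thesis using nth_\<phi>(2)[of "pad a b" k] nth_\<phi>(2)[of "pad c d" k] assms
      by (cases k) (auto simp: pad_def)
  qed
  then show "tl (\<phi> (pad a b)) ! i = tl (\<phi> (pad c d)) ! i"
    using i by (simp add: nth_tl length_\<phi>)
qed (simp add: length_\<phi>)

lemma last_\<phi>:
  assumes v: "length v = 2 * N"
  shows "drop (2 * N - 2) (\<phi> (drop 2 v @ [a, b])) = [first a b, second a b]"
proof -
  let ?w = "drop 2 v @ [a, b]"
  have w: "length ?w = 2 * N" using v N_pos by simp
  have N: "2 * (N - 1) = 2 * N - 2" "Suc (2 * N - 2) = 2 * N - 1" using N_pos by auto
  have "?w ! (2 * N - 2) = a" "?w ! Suc (2 * N - 2) = b" using v N_pos by (auto simp: nth_append)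
  then have "\<phi> ?w ! (2 * N - 2) = first a b" "\<phi> ?w ! Suc (2 * N - 2) = second a b"
    using nth_\<phi>[OF w, of "N - 1"] N_pos N(1) by auto
  moreover have "drop (2 * N - 2) (\<phi> ?w) = [\<phi> ?w ! (2 * N - 2), \<phi> ?w ! Suc (2 * N - 2)]"
    using length_\<phi>[OF w] N_pos by (simp add: Cons_nth_drop_Suc[symmetric])
  ultimately show ?thesis by simp
qed

section \<open>Separation of the two components\<close>

text \<open>The second player cannot tell apart two states with the same tail, so after a symmetry
  the answers to the same letter of the first player still agree.\<close>
lemma same_tail:
  assumes v: "length v = 2 * N" and w: "length w = 2 * N"
    and tl: "tl (\<phi> v) = tl (\<phi> w)"
    and first: "first (P v) (R (tl v @ [P v])) = first (P w) (R (tl w @ [P w]))"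
  shows "P v = P w \<and> R (tl v @ [P v]) = R (tl w @ [P w])"
proof -
  obtain P' R' where *: "\<And>v. length v = 2 * N \<Longrightarrow> \<phi> (step P R v) = step P' R' (\<phi> v)"
    using step_\<phi>[of P R] by blast
  have eq: "P' (\<phi> v) = first (P v) (R (tl v @ [P v])) \<and>
      R' (tl (\<phi> v) @ [P' (\<phi> v)]) = second (P v) (R (tl v @ [P v]))"
    if "length v = 2 * N" for v
    using *[OF that] last_\<phi>[OF that, of "P v" "R (tl v @ [P v])"] length_\<phi>[OF that]
    by (auto simp: step_def)
  have "second (P v) (R (tl v @ [P v])) = second (P w) (R (tl w @ [P w]))"
    using eq[OF v] eq[OF w] tl first by metis
  then show ?thesis using first_second_inj first by blast
qed

text \<open>Otherwise the images of \<open>pad a C\<close> and \<open>pad c D\<close> have the same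
  tail. By pigeonhole two distinct pairs share a value of \<open>first\<close>; answering the two
  states with these pairs contradicts \<open>same_tail\<close>.\<close>

lemma second_neq: "second a C \<noteq> second c D"
proof
  assume eq: "second a C = second c D"
  obtain x y x' y' where xy: "(x, y) \<noteq> (x', y')" "first x y = first x' y'"
  proof -
    have "first C C = first C D \<or> first C C = first D C \<or> first C D = first D C"
      by (cases "first C C"; cases "first C D"; cases "first D C") auto
    then show ?thesis
      using that[of C C C D] that[of C C D C] that[of C D D C] by auto
  qed
  \<comment> \<open>Both strategies read the second letter of the state. It differs between the two
    padded states and is the first letter of the word that the second player sees.\<close>
  define P where "P v = (if hd (tl v) = C then x else x')" for v
  define R where "R u = (if hd u = C then y else y')" for u
  have "P (pad a C) = P (pad c D) \<and> R (tl (pad a C) @ [P (pad a C)]) = R (tl (pad c D) @ [P (pad c D)])"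
    by (rule same_tail) (use tl_\<phi>_pad[OF eq] xy in \<open>auto simp: P_def R_def\<close>)
  then show False using xy by (auto simp: P_def R_def)
qed

text \<open>There are only two letters, and \<open>second a C\<close> and \<open>second c C\<close>
  both differ from \<open>second a D\<close>; similarly with \<open>C\<close> and \<open>D\<close>
  exchanged.\<close>

lemma second_cong: "second a b = second c b"
  using second_neq[of a a] second_neq[of a c] second_neq[of c a]
  by (cases b; cases "second a C"; cases "second a D"; cases "second c C"; cases "second c D") auto

text \<open>Let the first player repeat the first letter of the state, which the second player
  cannot see, and let the second player answer \<open>C\<close> by \<open>b\<close> and
  \<open>D\<close> by \<open>d\<close>. The states \<open>pad C C\<close> and \<open>pad D C\<close>
  have images with equal tails, so \<open>same_tail\<close> would make their first letters
  equal.\<close>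

lemma first_neq: "first C b \<noteq> first D d"
proof
  assume eq: "first C b = first D d"
  define R where "R u = (if last u = C then b else d)" for u
  have "hd (pad C C) = hd (pad D C) \<and> R (tl (pad C C) @ [hd (pad C C)]) = R (tl (pad D C) @ [hd (pad D C)])"
    by (rule same_tail) (use tl_\<phi>_pad[OF second_cong] eq in \<open>auto simp: R_def\<close>)
  then show False by simp
qed

lemma first_cong: "first a b = first a d"
  using first_neq[of b b] first_neq[of b d] first_neq[of d b]
  by (cases a; cases "first C b"; cases "first D b"; cases "first C d"; cases "first D d") auto

lemma \<phi>_flip_word: "\<exists>s t. \<forall>w. length w = 2 * N \<longrightarrow> \<phi> w = flip_word s t w"
proof -
  define s where "s \<longleftrightarrow> first C C = D"
  define t where "t \<longleftrightarrow> second C C = D"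
  have f: "first a b = flip s a" for a b
    using first_neq[of C C] first_cong[of a b C] unfolding s_def flip_def
    by (cases a; cases "first C C"; cases "first D C") auto
  have g: "second a b = flip t b" for a b
    using second_neq[of C C] second_cong[of a b C] unfolding t_def flip_def
    by (cases b; cases "second C C"; cases "second C D") auto
  have "\<phi> w = flip_word s t w" if "length w = 2 * N" for w
    by (rule \<phi>_eqI) (use that in \<open>auto simp: nth_flip_word f g\<close>)
  then show ?thesis by blast
qed

end

subsection \<open>Matrices indexed by words\<close>

abbreviation (input) word_set :: "nat \<Rightarrow> letter list set" where
  "word_set n \<equiv> {w. length w = n}"

text \<open>Replacing positions by the words they enumerate turns matrix identities into identities
  between kernels on words, with sums over words.\<close>

definition word_mat :: "nat \<Rightarrow> (letter list \<Rightarrow> letter list \<Rightarrow> real) \<Rightarrow> real mat" where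
  "word_mat n K = mat (2 ^ n) (2 ^ n) (\<lambda>(r, c). K (words n ! r) (words n ! c))"

definition word_vec :: "nat \<Rightarrow> (letter list \<Rightarrow> real) \<Rightarrow> real vec" where
  "word_vec n x = vec (2 ^ n) (\<lambda>i. x (words n ! i))"

lemma finite_words [simp]: "finite (word_set n)"
  by (metis List.finite_set set_words)

lemma distinct_words: "distinct (words n)"
  by (induction n) (auto simp: distinct_map)

lemma bij_betw_words: "bij_betw ((!) (words n)) {..<2 ^ n} (word_set n)"
  by (rule bij_betw_nth) (auto simp: distinct_words set_words)

lemma length_words_nth [simp]: "i < 2 ^ n \<Longrightarrow> length (words n ! i) = n"
  using bij_betw_words[of n] by (auto simp: bij_betw_def)

lemma ex_words_nth:
  assumes "length w = n"
  shows "\<exists>i<2 ^ n. words n ! i = w"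
proof -
  have "w \<in> set (words n)" using assms by (simp add: set_words)
  then show ?thesis by (auto simp: in_set_conv_nth)
qed

lemma words_nth_eq_iff:
  "i < 2 ^ n \<Longrightarrow> j < 2 ^ n \<Longrightarrow> words n ! i = words n ! j \<longleftrightarrow> i = j"
  by (simp add: nth_eq_iff_index_eq distinct_words)

lemma sum_words: "(\<Sum>i<2 ^ n. f (words n ! i)) = (\<Sum>w | length w = n. f w)"
  by (rule sum.reindex_bij_betw[OF bij_betw_words])

lemma sum_point_mass:
  fixes f :: "letter list \<Rightarrow> real"
  assumes "length c = n"
  shows "(\<Sum>v | length v = n. f v * of_bool (v = c)) = f c"
proof -
  have "(\<Sum>v | length v = n. f v * of_bool (v = c)) = (\<Sum>v | length v = n. if v = c then f v else 0)"
    by (intro sum.cong) auto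
  then show ?thesis using assms by simp
qed

lemma ex_word_mat:
  assumes "Q \<in> carrier_mat (2 ^ n) (2 ^ n)"
  shows "\<exists>K. Q = word_mat n K"
proof
  let ?ix = "inv_into {..<2 ^ n} ((!) (words n))"
  have "?ix (words n ! i) = i" if "i < 2 ^ n" for i
    using bij_betw_words[of n] that by (auto simp: bij_betw_def inv_into_f_f)
  then show "Q = word_mat n (\<lambda>v w. Q $$ (?ix v, ?ix w))"
    using assms by (intro eq_matI) (auto simp: word_mat_def)
qed

lemma ex_word_vec:
  assumes "x \<in> carrier_vec (2 ^ n)"
  shows "\<exists>f. x = word_vec n f"
proof
  let ?ix = "inv_into {..<2 ^ n} ((!) (words n))"
  have "?ix (words n ! i) = i" if "i < 2 ^ n" for i
    using bij_betw_words[of n] that by (auto simp: bij_betw_def inv_into_f_f)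
  then show "x = word_vec n (\<lambda>v. x $ ?ix v)"
    using assms by (intro eq_vecI) (auto simp: word_vec_def)
qed

lemma word_mat_carrier [simp]: "word_mat n K \<in> carrier_mat (2 ^ n) (2 ^ n)"
  by (simp add: word_mat_def)

lemma word_mat_mult:
  "word_mat n K * word_mat n L = word_mat n (\<lambda>v w. \<Sum>u | length u = n. K v u * L u w)"
  by (rule eq_matI)
    (auto simp: word_mat_def scalar_prod_def sum_words[symmetric] lessThan_atLeast0)

lemma word_mat_mult_vec:
  "word_mat n K *\<^sub>v word_vec n x = word_vec n (\<lambda>v. \<Sum>u | length u = n. K v u * x u)"
  by (rule eq_vecI)
    (auto simp: word_mat_def word_vec_def scalar_prod_def sum_words[symmetric] lessThan_atLeast0)

lemma transpose_word_mat: "transpose_mat (word_mat n K) = word_mat n (\<lambda>v w. K w v)"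
  by (rule eq_matI) (auto simp: word_mat_def)

lemma one_word_mat: "1\<^sub>m (2 ^ n) = word_mat n (\<lambda>v w. of_bool (v = w))"
  by (rule eq_matI) (auto simp: word_mat_def words_nth_eq_iff)

lemma word_mat_eq_iff:
  "word_mat n K = word_mat n L \<longleftrightarrow> (\<forall>v w. length v = n \<longrightarrow> length w = n \<longrightarrow> K v w = L v w)"
proof
  assume eq: "word_mat n K = word_mat n L"
  show "\<forall>v w. length v = n \<longrightarrow> length w = n \<longrightarrow> K v w = L v w"
  proof (intro allI impI)
    fix v w :: "letter list" assume "length v = n" "length w = n"
    then obtain i j where "i < 2 ^ n" "words n ! i = v" "j < 2 ^ n" "words n ! j = w"
      using ex_words_nth by metis
    then show "K v w = L v w"
      using arg_cong[OF eq, of "\<lambda>M. M $$ (i, j)"] by (simp add: word_mat_def)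
  qed
next
  assume "\<forall>v w. length v = n \<longrightarrow> length w = n \<longrightarrow> K v w = L v w"
  then show "word_mat n K = word_mat n L"
    by (intro eq_matI) (auto simp: word_mat_def)
qed

lemma word_vec_eq_iff:
  "word_vec n x = word_vec n y \<longleftrightarrow> (\<forall>v. length v = n \<longrightarrow> x v = y v)"
proof
  assume eq: "word_vec n x = word_vec n y"
  show "\<forall>v. length v = n \<longrightarrow> x v = y v"
  proof (intro allI impI)
    fix v :: "letter list" assume "length v = n"
    then obtain i where "i < 2 ^ n" "words n ! i = v"
      using ex_words_nth by metis
    then show "x v = y v"
      using arg_cong[OF eq, of "\<lambda>z. z $ i"] by (simp add: word_vec_def)
  qed
next
  assume "\<forall>v. length v = n \<longrightarrow> x v = y v"
  then show "word_vec n x = word_vec n y"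
    by (intro eq_vecI) (auto simp: word_vec_def)
qed

lemma real_orthogonal_word_mat:
  "real_orthogonal (2 ^ n) (word_mat n K) \<longleftrightarrow>
    (\<forall>v w. length v = n \<longrightarrow> length w = n \<longrightarrow>
      (\<Sum>u | length u = n. K v u * K w u) = of_bool (v = w) \<and>
      (\<Sum>u | length u = n. K u v * K u w) = of_bool (v = w))"
  unfolding real_orthogonal_def transpose_word_mat one_word_mat word_mat_mult word_mat_eq_iff
  by auto

lemma probability_word_vec:
  "probability_vec (2 ^ n) (word_vec n x) \<longleftrightarrow>
    (\<forall>v. length v = n \<longrightarrow> 0 \<le> x v) \<and> (\<Sum>v | length v = n. x v) = 1"
proof -
  have "(\<forall>i<2 ^ n. 0 \<le> x (words n ! i)) \<longleftrightarrow> (\<forall>v. length v = n \<longrightarrow> 0 \<le> x v)"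
    using ex_words_nth length_words_nth by metis
  then show ?thesis
    unfolding probability_vec_def sum_words[symmetric] by (auto simp: word_vec_def)
qed

lemma invariant_distribution_word:
  "invariant_distribution (2 ^ n) (word_mat n M) (word_vec n x) \<longleftrightarrow>
    (\<forall>v. length v = n \<longrightarrow> 0 \<le> x v) \<and> (\<Sum>v | length v = n. x v) = 1 \<and>
    (\<forall>w. length w = n \<longrightarrow> (\<Sum>v | length v = n. M v w * x v) = x w)"
  unfolding invariant_distribution_def probability_word_vec transpose_word_mat word_mat_mult_vec
    word_vec_eq_iff by simp

section \<open>Transition probabilities and pure strategies\<close>

lemma transition_mat_word: "transition_mat N p q = word_mat (2 * N) (transition_entry p q)"
  by (simp add: transition_mat_def word_mat_def)

lemma play_nonneg: "x \<in> {0..1} \<Longrightarrow> 0 \<le> play x a"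
  by (cases a) (auto simp: play_def)

lemma play_eq_1:
  assumes "x \<in> {0..1}" "y \<in> {0..1}" "play x a * play y b = 1"
  shows "play x a = 1 \<and> play y b = 1"
proof -
  have "0 \<le> play x a" "play x a \<le> 1" "0 \<le> play y b" "play y b \<le> 1"
    using assms(1,2) by (auto simp: play_def split: letter.splits)
  then show ?thesis
    using assms(3) mult_left_le[of "play x a" "play y b"] mult_left_le[of "play y b" "play x a"]
    by (auto simp: mult.commute)
qed

lemma play_1_iff: "play x a = 1 \<Longrightarrow> a = (if x = 1 then C else D)"
  by (cases a) (auto simp: play_def)

lemma strategiesD: "p \<in> strategies N \<Longrightarrow> length v = 2 * N \<Longrightarrow> p v \<in> {0..1}"
  unfolding strategies_def by (auto dest: PiE_mem)

lemma transition_entry_move: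
  "transition_entry p q v (drop 2 v @ [a, b]) = play (p v) a * play (q (tl v @ [a])) b"
  by (simp add: transition_entry_def butlast_append)

lemma transition_entry_nonzero:
  assumes "transition_entry p q v w \<noteq> 0"
  obtains a b where "w = drop 2 v @ [a, b]"
  using assms by (auto simp: transition_entry_def Let_def split: if_splits)

lemma transition_entry_nonneg:
  assumes "p \<in> strategies N" "q \<in> strategies N" "length v = 2 * N" "1 \<le> N"
  shows "0 \<le> transition_entry p q v w"
proof (cases "transition_entry p q v w = 0")
  case False
  then obtain a b where w: "w = drop 2 v @ [a, b]"
    by (rule transition_entry_nonzero)
  show ?thesis
    unfolding w transition_entry_move using assms
    by (intro mult_nonneg_nonneg play_nonneg strategiesD) auto
qed simp

text \<open>Only the four legal successors contribute, and their weights add up to 1 for each player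
  separately.\<close>

lemma sum_transition_entry:
  assumes "length v = 2 * N" "1 \<le> N"
  shows "(\<Sum>w | length w = 2 * N. transition_entry p q v w) = 1"
proof -
  let ?w = "\<lambda>a b. drop 2 v @ [a, b]"
  have "(\<Sum>w | length w = 2 * N. transition_entry p q v w)
      = (\<Sum>w\<in>{?w C C, ?w C D, ?w D C, ?w D D}. transition_entry p q v w)"
  proof (rule sum.mono_neutral_right)
    show "\<forall>w \<in> {w. length w = 2 * N} - {?w C C, ?w C D, ?w D C, ?w D D}. transition_entry p q v w = 0"
    proof
      fix w assume w: "w \<in> {w. length w = 2 * N} - {?w C C, ?w C D, ?w D C, ?w D D}"
      have "w \<noteq> ?w a b" for a b
        using w by (cases a; cases b) auto
      then show "transition_entry p q v w = 0"
        using transition_entry_nonzero by metis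
    qed
  qed (use assms in auto)
  also have "\<dots> = 1"
    by (simp add: transition_entry_move) (simp add: play_def algebra_simps)
  finally show ?thesis .
qed

text \<open>A strategy value is the probability of \<open>C\<close>. The restriction is there
  because \<open>strategies\<close> consists of extensional functions.\<close>

definition pure :: "nat \<Rightarrow> (letter list \<Rightarrow> letter) \<Rightarrow> letter list \<Rightarrow> real" where
  "pure N P = restrict (\<lambda>v. of_bool (P v = C)) {v. length v = 2 * N}"

lemma pure_strategies [simp]: "pure N P \<in> strategies N"
  by (auto simp: pure_def strategies_def)

lemma play_of_bool: "play (of_bool (x = C)) a = of_bool (a = x)"
  by (cases a; cases x) (auto simp: play_def)

lemma transition_entry_pure:
  assumes "length v = 2 * N" "1 \<le> N"
  shows "transition_entry (pure N P) (pure N R) v w = of_bool (w = step P R v)"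
proof (cases "\<exists>a b. w = drop 2 v @ [a, b]")
  case True
  then obtain a b where w: "w = drop 2 v @ [a, b]" by blast
  show ?thesis
    unfolding w transition_entry_move using assms
    by (auto simp: pure_def play_of_bool step_def)
next
  case False
  then show ?thesis
    using transition_entry_nonzero by (metis of_bool_eq(1) step_def)
qed

subsection \<open>Admissible matrices permute words\<close>

locale admissible_kernel =
  fixes N :: nat and K :: "letter list \<Rightarrow> letter list \<Rightarrow> real"
  assumes N_pos: "1 \<le> N"
    and orth: "real_orthogonal (2 ^ (2 * N)) (word_mat (2 * N) K)"
    and adm: "admissible N (word_mat (2 * N) K)"
begin

abbreviation (input) "W \<equiv> {w :: letter list. length w = 2 * N}"

abbreviation (input) "Z \<equiv> {z :: letter list. length z = 2 * N - 2}"

lemma orth_rows: "length v = 2 * N \<Longrightarrow> length w = 2 * N \<Longrightarrow> (\<Sum>u\<in>W. K v u * K w u) = of_bool (v = w)"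
  and orth_cols: "length v = 2 * N \<Longrightarrow> length w = 2 * N \<Longrightarrow> (\<Sum>u\<in>W. K u v * K u w) = of_bool (v = w)"
  using orth unfolding real_orthogonal_word_mat by auto

lemma step_in_W: "length v = 2 * N \<Longrightarrow> length (step P R v) = 2 * N"
  using N_pos by (simp add: length_step)

text \<open>The matrix of a pure profile has a single 1 in each row, so the double sum of the
  conjugation collapses to one over \<open>v\<close>. Of the invariance condition only the
  probability property is kept, for use in \<open>column_sum\<close>.\<close>

lemma pure_image:
  obtains p q where "p \<in> strategies N" "q \<in> strategies N"
    and "\<And>r c. length r = 2 * N \<Longrightarrow> length c = 2 * N \<Longrightarrow>
      (\<Sum>v\<in>W. K r v * K c (step P R v)) = transition_entry p q r c"
    and "\<And>x. invariant_distribution (2 ^ (2 * N)) (transition_mat N (pure N P) (pure N R)) x \<Longrightarrow>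
      probability_vec (2 ^ (2 * N)) (word_mat (2 * N) K *\<^sub>v x)"
proof -
  let ?M = "transition_mat N (pure N P) (pure N R)" and ?K = "word_mat (2 * N) K"
  obtain p q where pq: "p \<in> strategies N" "q \<in> strategies N"
    and eq: "?K * ?M * transpose_mat ?K = transition_mat N p q"
    and inv: "\<And>x. invariant_distribution (2 ^ (2 * N)) ?M x \<Longrightarrow>
      invariant_distribution (2 ^ (2 * N)) (transition_mat N p q) (?K *\<^sub>v x)"
    using adm unfolding admissible_def by (meson pure_strategies)
  have "(\<Sum>v\<in>W. K r v * K c (step P R v)) = transition_entry p q r c"
    if rc: "length r = 2 * N" "length c = 2 * N" for r c
  proof -
    have "transition_entry p q r c =
      (\<Sum>u\<in>W. (\<Sum>v\<in>W. K r v * transition_entry (pure N P) (pure N R) v u) * K c u)"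
      using eq rc by (simp add: transition_mat_word transpose_word_mat word_mat_mult word_mat_eq_iff)
    also have "\<dots> = (\<Sum>v\<in>W. \<Sum>u\<in>W. K r v * transition_entry (pure N P) (pure N R) v u * K c u)"
      unfolding sum_distrib_right by (rule sum.swap)
    also have "\<dots> = (\<Sum>v\<in>W. \<Sum>u\<in>W. if u = step P R v then K r v * K c u else 0)"
      using N_pos by (intro sum.cong) (auto simp: transition_entry_pure)
    also have "\<dots> = (\<Sum>v\<in>W. K r v * K c (step P R v))"
      by (intro sum.cong) (auto simp: step_in_W)
    finally show ?thesis by simp
  qed
  moreover have "probability_vec (2 ^ (2 * N)) (?K *\<^sub>v x)"
    if "invariant_distribution (2 ^ (2 * N)) ?M x" for x
    using inv[OF that] by (simp add: invariant_distribution_def)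
  ultimately show ?thesis by (rule that[OF pq])
qed

text \<open>The vector of column sums is harmonic for every transition matrix, hence constant; its value
  is read off from the point mass at the absorbing word \<open>C \<dots> C\<close>.\<close>
lemma column_sum:
  assumes w: "length w = 2 * N"
  shows "(\<Sum>r\<in>W. K r w) = 1"
proof -
  define h where "h w = (\<Sum>r\<in>W. K r w)" for w
  define s where "s = step (\<lambda>_. C) (\<lambda>_. C)"
  let ?c = "replicate (2 * N) C"
  obtain p q where "p \<in> strategies N" "q \<in> strategies N" and pq: "\<And>r c. length r = 2 * N \<Longrightarrow> length c = 2 * N \<Longrightarrow>
      (\<Sum>v\<in>W. K r v * K c (step (\<lambda>_. C) (\<lambda>_. C) v)) = transition_entry p q r c"
    and prob: "\<And>x. invariant_distribution (2 ^ (2 * N))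
        (transition_mat N (pure N (\<lambda>_. C)) (pure N (\<lambda>_. C))) x \<Longrightarrow>
      probability_vec (2 ^ (2 * N)) (word_mat (2 * N) K *\<^sub>v x)"
    by (rule pure_image[of "\<lambda>_. C" "\<lambda>_. C"]) (rule that)
  have row: "(\<Sum>v\<in>W. K r v * h (s v)) = 1" if "length r = 2 * N" for r
  proof -
    have "(\<Sum>v\<in>W. K r v * h (s v)) = (\<Sum>c\<in>W. \<Sum>v\<in>W. K r v * K c (s v))"
      unfolding h_def sum_distrib_left by (rule sum.swap)
    also have "\<dots> = 1"
      using pq[folded s_def] that sum_transition_entry N_pos by simp
    finally show ?thesis .
  qed
  \<comment> \<open>With \<open>1\<close> the all-ones vector, \<open>row\<close> says that
    \<open>K\<close> maps \<open>h o s\<close> to \<open>1\<close>. Applying the transpose and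
    orthogonality gives \<open>h o s = K^T 1 = h\<close>.\<close>
  have h_s: "h (s w) = h w" if w: "length w = 2 * N" for w
  proof -
    have "h w = (\<Sum>r\<in>W. \<Sum>v\<in>W. K r w * (K r v * h (s v)))"
      unfolding h_def[of w] sum_distrib_left[symmetric] using row by simp
    also have "\<dots> = (\<Sum>v\<in>W. (\<Sum>r\<in>W. K r v * K r w) * h (s v))"
      unfolding sum_distrib_right by (subst sum.swap) (simp add: mult_ac)
    also have "\<dots> = (\<Sum>v\<in>W. if v = w then h (s v) else 0)"
      using w by (intro sum.cong) (auto simp: orth_cols)
    also have "\<dots> = h (s w)" using w by simp
    finally show ?thesis by simp
  qed
  have rep: "replicate (2 * Suc k) C = replicate (2 * k) C @ [C, C]" for k
    using replicate_add[of "2 * k" 2 C] by (simp add: numeral_2_eq_2)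
  \<comment> \<open>Each application of \<open>s\<close> appends \<open>C C\<close>; after
    \<open>N\<close> of them every word has become \<open>?c\<close>.\<close>
  have h_shift: "h (drop (2 * k) w @ replicate (2 * k) C) = h w" if "k \<le> N" for k
    using that
  proof (induction k)
    case (Suc k)
    let ?x = "drop (2 * k) w @ replicate (2 * k) C"
    have "drop 2 ?x = drop (2 * Suc k) w @ replicate (2 * k) C"
      using Suc.prems w by (simp add: drop_append)
    then have "s ?x = drop (2 * Suc k) w @ replicate (2 * Suc k) C"
      by (simp only: s_def step_def rep append_assoc)
    then show ?case using h_s[of ?x] Suc w by simp
  qed simp
  have "transition_entry (pure N (\<lambda>_. C)) (pure N (\<lambda>_. C)) ?c w = of_bool (w = ?c)" for w
  proof -
    have "step (\<lambda>_. C) (\<lambda>_. C) ?c = replicate (2 * (N - 1)) C @ [C, C]"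
      by (simp add: step_def diff_mult_distrib2)
    also have "\<dots> = ?c"
      using rep[of "N - 1"] N_pos by simp
    finally have "step (\<lambda>_. C) (\<lambda>_. C) ?c = ?c" .
    then show ?thesis using N_pos by (subst transition_entry_pure) auto
  qed
  then have "invariant_distribution (2 ^ (2 * N))
        (transition_mat N (pure N (\<lambda>_. C)) (pure N (\<lambda>_. C))) (word_vec (2 * N) (\<lambda>w. of_bool (w = ?c)))"
    unfolding transition_mat_word invariant_distribution_word
    using sum_point_mass[of ?c "2 * N" "\<lambda>_. 1"] by (simp add: sum_point_mass)
  then have "probability_vec (2 ^ (2 * N))
      (word_mat (2 * N) K *\<^sub>v word_vec (2 * N) (\<lambda>w. of_bool (w = ?c)))"
    by (rule prob)
  \<comment> \<open>\<open>h ?c\<close> is the total mass of the image of the point mass at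
    \<open>?c\<close>.\<close>
  then have "h ?c = 1"
    unfolding word_mat_mult_vec probability_word_vec h_def by (simp add: sum_point_mass)
  then have "h w = 1"
    using h_shift[of N] w by simp
  then show ?thesis by (simp add: h_def)
qed

text \<open>From \<open>K^T 1 = 1\<close> follows \<open>K 1 = K K^T 1 = 1\<close>.\<close>

lemma row_sum:
  assumes r: "length r = 2 * N"
  shows "(\<Sum>w\<in>W. K r w) = 1"
proof -
  have "(\<Sum>w\<in>W. K r w) = (\<Sum>w\<in>W. \<Sum>c\<in>W. K r w * K c w)"
    unfolding sum_distrib_left[symmetric] by (simp add: column_sum)
  also have "\<dots> = (\<Sum>c\<in>W. of_bool (r = c))"
    by (subst sum.swap) (simp add: orth_rows r)
  also have "\<dots> = 1" using r by (simp add: of_bool_def)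
  finally show ?thesis .
qed

section \<open>Row weights on blocks of words with a common suffix\<close>

definition block_sum :: "letter list \<Rightarrow> letter list \<Rightarrow> real" where
  "block_sum z r = (\<Sum>v | length v = 2 * N \<and> drop 2 v = z. K r v)"

lemma sum_blocks:
  "(\<Sum>v\<in>W. K r v * f (drop 2 v)) = (\<Sum>z\<in>Z. block_sum z r * f z)"
proof -
  have "(\<Sum>v\<in>W. K r v * f (drop 2 v))
      = (\<Sum>z\<in>Z. \<Sum>v | v \<in> W \<and> drop 2 v = z. K r v * f (drop 2 v))"
    by (rule sum.group[symmetric]) auto
  also have "\<dots> = (\<Sum>z\<in>Z. block_sum z r * f z)"
    unfolding block_sum_def sum_distrib_right by (intro sum.cong) auto
  finally show ?thesis .
qed

lemma sum_block_sum: "length r = 2 * N \<Longrightarrow> (\<Sum>z\<in>Z. block_sum z r) = 1"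
  using sum_blocks[of r "\<lambda>_. 1"] row_sum[of r] by simp

text \<open>If both answers depend only on the suffix \<open>z\<close>, all four words of its block
  have the same successor, so the rows of \<open>K\<close> enter the image only through their block
  sums.\<close>

lemma reset_image:
  obtains p q where "p \<in> strategies N" "q \<in> strategies N"
    and "\<And>r c. length r = 2 * N \<Longrightarrow> length c = 2 * N \<Longrightarrow>
      (\<Sum>z\<in>Z. block_sum z r * K c (z @ [f z, g z])) = transition_entry p q r c"
proof -
  define P where "P v = f (drop 2 v)" for v
  \<comment> \<open>Here \<open>u\<close> is \<open>tl v\<close> followed by the new letter, so
    \<open>tl (butlast u)\<close> is \<open>drop 2 v\<close>.\<close>
  define R where "R u = g (tl (butlast u))" for u
  have "step P R v = drop 2 v @ [f (drop 2 v), g (drop 2 v)]" if "length v = 2 * N" for v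
    using that N_pos by (simp add: step_def P_def R_def drop_Suc numeral_2_eq_2)
  then have "(\<Sum>v\<in>W. K r v * K c (step P R v))
      = (\<Sum>z\<in>Z. block_sum z r * K c (z @ [f z, g z]))" for r c
    by (subst sum_blocks[symmetric]) simp
  moreover obtain p q where "p \<in> strategies N" "q \<in> strategies N"
    and "\<And>r c. length r = 2 * N \<Longrightarrow> length c = 2 * N \<Longrightarrow>
      (\<Sum>v\<in>W. K r v * K c (step P R v)) = transition_entry p q r c"
    by (rule pure_image[of P R]) (rule that)
  ultimately show ?thesis using that[of p q] by simp
qed

text \<open>Changing a pure strategy only after the words ending in \<open>z\<close> changes the image of the
  transition matrix by a matrix of rank one. Its support must consist of legal moves, and
  a product set of legal moves has all its rows in one block.\<close>
lemma block_sum_support: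
  assumes z: "length z = 2 * N - 2"
  shows "\<exists>y. \<forall>r. length r = 2 * N \<longrightarrow> block_sum z r \<noteq> 0 \<longrightarrow> drop 2 r = y"
proof -
  let ?w = "z @ [C, C]" and ?w' = "z @ [C, D]"
  have w: "length ?w = 2 * N" "length ?w' = 2 * N" using z N_pos by auto
  \<comment> \<open>Two orthonormal columns cannot coincide. The choice of \<open>c\<close> does not
    involve \<open>r\<close>, so \<open>take (2 * N - 2) c\<close> can serve as the common
    suffix.\<close>
  have "\<exists>c. length c = 2 * N \<and> K c ?w \<noteq> K c ?w'"
  proof (rule ccontr)
    assume "\<not> ?thesis"
    then have "(\<Sum>u\<in>W. K u ?w * K u ?w') = (\<Sum>u\<in>W. K u ?w * K u ?w)"
      by (intro sum.cong) auto
    then show False using orth_cols w by simp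
  qed
  then obtain c where c: "length c = 2 * N" "K c ?w \<noteq> K c ?w'" by blast
  obtain p q where "p \<in> strategies N" "q \<in> strategies N" and 1: "\<And>r c. length r = 2 * N \<Longrightarrow> length c = 2 * N \<Longrightarrow>
      (\<Sum>x\<in>Z. block_sum x r * K c (x @ [C, C])) = transition_entry p q r c"
    by (rule reset_image[of "\<lambda>_. C" "\<lambda>_. C"]) (rule that)
  obtain p' q' where "p' \<in> strategies N" "q' \<in> strategies N" and 2: "\<And>r c. length r = 2 * N \<Longrightarrow> length c = 2 * N \<Longrightarrow>
      (\<Sum>x\<in>Z. block_sum x r * K c (x @ [C, if x = z then D else C])) = transition_entry p' q' r c"
    by (rule reset_image[of "\<lambda>_. C" "\<lambda>x. if x = z then D else C"]) (rule that)
  have "drop 2 r = take (2 * N - 2) c" if r: "length r = 2 * N" "block_sum z r \<noteq> 0" for r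
  proof -
    have "transition_entry p q r c - transition_entry p' q' r c
        = (\<Sum>x\<in>Z. if x = z then block_sum z r * (K c ?w - K c ?w') else 0)"
      unfolding 1[OF r(1) c(1), symmetric] 2[OF r(1) c(1), symmetric] sum_subtractf[symmetric]
      by (intro sum.cong) (auto simp: algebra_simps)
    also have "\<dots> = block_sum z r * (K c ?w - K c ?w')"
      using z by simp
    finally have "transition_entry p q r c \<noteq> 0 \<or> transition_entry p' q' r c \<noteq> 0"
      using r c by auto
    then obtain a b where "c = drop 2 r @ [a, b]"
      using transition_entry_nonzero by metis
    then show ?thesis using r by simp
  qed
  then show ?thesis by blast
qed

text \<open>Each block is sent into a single block \<open>\<sigma> z\<close>, and since the block
  sums of a row add up to 1, every block is hit; so \<open>\<sigma>\<close> permutes the blocks. In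
  a row with suffix \<open>\<sigma> z\<close> only block \<open>z\<close> contributes, with weight
  1, and constant answers \<open>a\<close>, \<open>b\<close> then exhibit \<open>K c w\<close> as a
  transition probability.\<close>

lemma kernel_nonneg:
  assumes c: "length c = 2 * N" and w: "length w = 2 * N"
  shows "0 \<le> K c w"
proof -
  have "\<forall>z. \<exists>y. length z = 2 * N - 2 \<longrightarrow>
      (\<forall>r. length r = 2 * N \<longrightarrow> block_sum z r \<noteq> 0 \<longrightarrow> drop 2 r = y)"
    using block_sum_support by blast
  then obtain \<sigma> where "\<forall>z. length z = 2 * N - 2 \<longrightarrow>
      (\<forall>r. length r = 2 * N \<longrightarrow> block_sum z r \<noteq> 0 \<longrightarrow> drop 2 r = \<sigma> z)"
    by metis
  then have \<sigma>: "drop 2 r = \<sigma> z"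
    if "length z = 2 * N - 2" "length r = 2 * N" "block_sum z r \<noteq> 0" for z r
    using that by blast
  have sub: "Z \<subseteq> \<sigma> ` Z"
  proof
    fix y assume y: "y \<in> Z"
    let ?r = "[C, C] @ y"
    have r: "length ?r = 2 * N" using y N_pos by auto
    obtain z where "z \<in> Z" "block_sum z ?r \<noteq> 0"
      using sum_block_sum[OF r] by (metis (no_types, lifting) sum.neutral zero_neq_one)
    then show "y \<in> \<sigma> ` Z" using \<sigma>[of z ?r] r by (auto intro!: image_eqI[of _ _ z])
  qed
  have "card (\<sigma> ` Z) = card Z"
    by (intro antisym card_image_le card_mono sub) auto
  then have inj: "inj_on \<sigma> Z" and onto: "\<sigma> ` Z = Z"
    using eq_card_imp_inj_on[of Z \<sigma>] card_subset_eq[OF _ sub] by auto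
  define z where "z = take (2 * N - 2) w"
  have z: "z \<in> Z" using w by (simp add: z_def)
  have "length (drop (2 * N - 2) w) = Suc (Suc 0)" using w N_pos by simp
  then obtain a b where "drop (2 * N - 2) w = [a, b]"
    by (auto simp: length_Suc_conv simp del: length_drop)
  then have w_eq: "w = z @ [a, b]" by (metis append_take_drop_id z_def)
  let ?r = "[C, C] @ \<sigma> z"
  have "\<sigma> z \<in> Z" using onto z by blast
  then have r: "length ?r = 2 * N" using N_pos by simp
  have zero: "block_sum x ?r = 0" if "x \<in> Z" "x \<noteq> z" for x
    using \<sigma>[of x ?r] r inj z that by (auto dest: inj_onD)
  have "(\<Sum>x\<in>Z. block_sum x ?r) = block_sum z ?r"
    using zero z by (subst sum.remove[of _ z]) auto
  then have one: "block_sum z ?r = 1"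
    using sum_block_sum[OF r] by simp
  obtain p q where pq: "p \<in> strategies N" "q \<in> strategies N"
    and eq: "\<And>r c. length r = 2 * N \<Longrightarrow> length c = 2 * N \<Longrightarrow>
      (\<Sum>z\<in>Z. block_sum z r * K c (z @ [a, b])) = transition_entry p q r c"
    by (rule reset_image[of "\<lambda>_. a" "\<lambda>_. b"]) (rule that)
  have "(\<Sum>z\<in>Z. block_sum z ?r * K c (z @ [a, b])) = K c w"
    using zero z one w_eq by (subst sum.remove[of _ z]) auto
  then show ?thesis
    using eq[OF r c] transition_entry_nonneg[OF pq r N_pos, of c] by simp
qed

text \<open>The entries \<open>x\<close> of a column lie between 0 and 1, and both they and their
  squares sum to 1; so the nonnegative terms \<open>x * (1 - x)\<close> sum to 0.\<close>

lemma kernel_01: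
  assumes c: "length c = 2 * N" and w: "length w = 2 * N"
  shows "K c w = 0 \<or> K c w = 1"
proof -
  have le: "K r w \<le> 1" if "length r = 2 * N" for r
  proof -
    have "K r w \<le> (\<Sum>c\<in>W. K c w)"
      using that w by (intro member_le_sum) (auto simp: kernel_nonneg)
    then show ?thesis by (simp add: column_sum w)
  qed
  have "(\<Sum>r\<in>W. K r w * (1 - K r w)) = 0"
    using orth_cols[OF w w] column_sum[OF w] by (simp add: algebra_simps sum_subtractf)
  moreover have "\<forall>r\<in>W. 0 \<le> K r w * (1 - K r w)"
    using le kernel_nonneg w by simp
  ultimately have "K c w * (1 - K c w) = 0"
    using c sum_nonneg_eq_0_iff[of W "\<lambda>r. K r w * (1 - K r w)"] finite_words by blast
  then show ?thesis by auto
qed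

text \<open>The position of the only 1 in column \<open>w\<close>: the matrix sends the unit vector
  of \<open>w\<close> to that of \<open>image_word w\<close>.\<close>

definition image_word :: "letter list \<Rightarrow> letter list" where
  "image_word w = (THE c. length c = 2 * N \<and> K c w = 1)"

lemma kernel_image_word:
  assumes w: "length w = 2 * N"
  shows "length (image_word w) = 2 * N"
    and "length c = 2 * N \<Longrightarrow> K c w = of_bool (c = image_word w)"
proof -
  obtain c0 where c0: "length c0 = 2 * N" "K c0 w = 1"
    using column_sum[OF w] kernel_01[OF _ w]
    by (metis (mono_tags, lifting) mem_Collect_eq sum.neutral zero_neq_one)
  have "K c w = 0" if c: "length c = 2 * N" "c \<noteq> c0" for c
  proof -
    have "K c w \<le> (\<Sum>r\<in>W - {c0}. K r w)"
      using c w by (intro member_le_sum) (auto simp: kernel_nonneg)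
    also have "\<dots> = 0"
      using column_sum[OF w] c0 by (simp add: sum_diff1)
    finally show ?thesis using kernel_nonneg[OF c(1) w] by simp
  qed
  then have *: "length c = 2 * N \<Longrightarrow> K c w = of_bool (c = c0)" for c
    using c0 by auto
  then have "image_word w = c0"
    unfolding image_word_def using c0 by (intro the_equality) auto
  then show "length (image_word w) = 2 * N"
    and "length c = 2 * N \<Longrightarrow> K c w = of_bool (c = image_word w)"
    using c0 * by auto
qed

text \<open>Equal images would give two columns with inner product 1.\<close>

lemma inj_image_word: "inj_on image_word W"
proof (rule inj_onI)
  fix v w assume vw: "v \<in> W" "w \<in> W" "image_word v = image_word w"
  then have "(\<Sum>u\<in>W. K u v * K u w) = (\<Sum>u\<in>W. if u = image_word w then 1 else 0)"
    by (intro sum.cong) (auto simp: kernel_image_word)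
  also have "\<dots> = 1" using vw kernel_image_word(1) by simp
  finally show "v = w" using orth_cols vw by (auto split: if_splits)
qed

text \<open>The transformed chain moves from \<open>image_word v\<close> to the image of the
  successor of \<open>v\<close> with probability 1. A product of two probabilities is 1 only if both
  are, so the transformed players act deterministically along these moves.\<close>

lemma image_word_step:
  "\<exists>P' R'. \<forall>v. length v = 2 * N \<longrightarrow> image_word (step P R v) = step P' R' (image_word v)"
proof -
  obtain p q where pq: "p \<in> strategies N" "q \<in> strategies N"
    and eq: "\<And>r c. length r = 2 * N \<Longrightarrow> length c = 2 * N \<Longrightarrow>
      (\<Sum>v\<in>W. K r v * K c (step P R v)) = transition_entry p q r c"
    by (rule pure_image[of P R]) (rule that)
  \<comment> \<open>Along the moves considered \<open>p\<close> and \<open>q\<close> take only the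
    values 0 and 1, so testing for 1 recovers the letter played.\<close>
  define P' where "P' v = (if p v = 1 then C else D)" for v
  define R' where "R' u = (if q u = 1 then C else D)" for u
  have "image_word (step P R v) = step P' R' (image_word v)" if v: "length v = 2 * N" for v
  proof -
    let ?r = "image_word v" and ?c = "image_word (step P R v)"
    have r: "length ?r = 2 * N" and c: "length ?c = 2 * N"
      using v step_in_W kernel_image_word(1) by auto
    have "transition_entry p q ?r ?c = (\<Sum>u\<in>W. if u = v then 1 else 0)"
      unfolding eq[OF r c, symmetric]
    proof (intro sum.cong refl)
      fix u assume "u \<in> W"
      then have "K ?r u = of_bool (u = v)"
        using r v inj_image_word by (auto simp: kernel_image_word dest: inj_onD)
      then show "K ?r u * K ?c (step P R u) = (if u = v then 1 else 0)"
        using v c by (auto simp: kernel_image_word step_in_W)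
    qed
    also have "\<dots> = 1" using v by simp
    finally have 1: "transition_entry p q ?r ?c = 1" .
    then obtain a b where ab: "?c = drop 2 ?r @ [a, b]"
      using transition_entry_nonzero by (metis zero_neq_one)
    have "play (p ?r) a * play (q (tl ?r @ [a])) b = 1"
      using 1 unfolding ab transition_entry_move .
    then have "play (p ?r) a = 1 \<and> play (q (tl ?r @ [a])) b = 1"
      using pq r N_pos by (intro play_eq_1) (auto intro!: strategiesD simp del: atLeastAtMost_iff)
    then have "a = P' ?r" "b = R' (tl ?r @ [a])"
      unfolding P'_def R'_def by (auto dest: play_1_iff)
    then show ?thesis using ab by (simp add: step_def)
  qed
  then show ?thesis by blast
qed

lemma kernel_flip_word:
  "\<exists>s t. \<forall>v w. length v = 2 * N \<longrightarrow> length w = 2 * N \<longrightarrow> K v w = of_bool (v = flip_word s t w)"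
proof -
  interpret step_symmetry N image_word
    by (rule step_symmetry.intro[OF N_pos kernel_image_word(1) inj_image_word image_word_step])
  obtain s t where "\<And>w. length w = 2 * N \<Longrightarrow> image_word w = flip_word s t w"
    using \<phi>_flip_word by blast
  then have "\<forall>v w. length v = 2 * N \<longrightarrow> length w = 2 * N \<longrightarrow> K v w = of_bool (v = flip_word s t w)"
    using kernel_image_word(2) by simp
  then show ?thesis by blast
qed

end

subsection \<open>Flipping the letters of each player\<close>

text \<open>The permutation matrix of an involution, hence symmetric.\<close>

definition flip_word_mat :: "nat \<Rightarrow> bool \<Rightarrow> bool \<Rightarrow> real mat" where
  "flip_word_mat n s t = word_mat n (\<lambda>v w. of_bool (v = flip_word s t w))"

lemma sum_flip_word_left:
  fixes f :: "letter list \<Rightarrow> real"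
  assumes "length v = n"
  shows "(\<Sum>u | length u = n. of_bool (v = flip_word s t u) * f u) = f (flip_word s t v)"
proof -
  have "v = flip_word s t u \<longleftrightarrow> u = flip_word s t v" for u by auto
  then show ?thesis
    using sum_point_mass[of "flip_word s t v" n f] assms by (simp only: mult.commute length_flip_word)
qed

lemma sum_flip_word_right:
  fixes f :: "letter list \<Rightarrow> real"
  assumes "length v = n"
  shows "(\<Sum>u | length u = n. f u * of_bool (v = flip_word s t u)) = f (flip_word s t v)"
  using sum_flip_word_left[OF assms, of s t f] by (simp only: mult.commute)

lemma sum_flip_word: "(\<Sum>u | length u = n. f (flip_word s t u)) = (\<Sum>u | length u = n. f u)"
  by (rule sum.reindex_bij_witness[where i = "flip_word s t" and j = "flip_word s t"]) auto

lemma flip_word_mat_orthogonal: "real_orthogonal (2 ^ n) (flip_word_mat n s t)"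
proof -
  have "(\<Sum>u | length u = n. of_bool (u = flip_word s t v) * of_bool (u = flip_word s t w)) = (of_bool (v = w) :: real)"
    if "length v = n" "length w = n" for v w
  proof -
    have "flip_word s t v = flip_word s t w \<longleftrightarrow> v = w" by (metis flip_word_flip_word)
    moreover have "u = flip_word s t v \<longleftrightarrow> v = flip_word s t u" for u by auto
    ultimately show ?thesis
      using sum_flip_word_left[of v n s t "\<lambda>u. of_bool (u = flip_word s t w)"] that
      by (simp only:)
  qed
  moreover have "(\<Sum>u | length u = n. of_bool (v = flip_word s t u) * of_bool (w = flip_word s t u)) = (of_bool (v = w) :: real)"
    if "length v = n" "length w = n" for v w
    using that sum_flip_word_left[of v n s t "\<lambda>u. of_bool (w = flip_word s t u)"]
    by (simp only: flip_word_flip_word eq_commute[of w])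
  ultimately show ?thesis
    unfolding flip_word_mat_def real_orthogonal_word_mat by blast
qed

definition flip_prob :: "bool \<Rightarrow> real \<Rightarrow> real" where
  "flip_prob s x = (if s then 1 - x else x)"

lemma play_flip_prob: "play (flip_prob s x) a = play x (flip s a)"
  by (cases a) (auto simp: play_def flip_prob_def flip_def)

text \<open>The transported strategy undoes the flips in the word it reads and flips its own answer.
  The first flag always belongs to the player's own letters, so the second player uses the flags in
  the order \<open>t\<close>, \<open>s\<close>.\<close>

definition flip_strategy ::
  "nat \<Rightarrow> bool \<Rightarrow> bool \<Rightarrow> (letter list \<Rightarrow> real) \<Rightarrow> letter list \<Rightarrow> real" where
  "flip_strategy N s t p = restrict (\<lambda>v. flip_prob s (p (flip_word s t v))) {v. length v = 2 * N}"

lemma flip_strategy: "p \<in> strategies N \<Longrightarrow> flip_strategy N s t p \<in> strategies N"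
  using strategiesD[of p N]
  by (fastforce simp: flip_strategy_def strategies_def flip_prob_def intro!: PiE_I)

text \<open>Flipping commutes with dropping two letters, while \<open>tl\<close> exchanges the
  flags, exactly as the second player's strategy expects.\<close>

lemma transition_entry_flip:
  assumes v: "length v = 2 * N" and N: "1 \<le> N"
  shows "transition_entry (flip_strategy N s t p) (flip_strategy N t s q) v w
    = transition_entry p q (flip_word s t v) (flip_word s t w)"
proof (cases "\<exists>a b. w = drop 2 v @ [a, b]")
  case True
  then obtain a b where w: "w = drop 2 v @ [a, b]" by blast
  have "flip_word s t w = drop 2 (flip_word s t v) @ [flip s a, flip t b]"
    using v by (simp add: w flip_word_append drop2_flip_word)
  moreover have "flip_word t s (tl v @ [a]) = tl (flip_word s t v) @ [flip s a]"
    using v N by (simp add: flip_word_append tl_flip_word)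
  ultimately show ?thesis
    using v N by (simp add: w transition_entry_move flip_strategy_def play_flip_prob)
next
  case False
  have "transition_entry p q (flip_word s t v) (flip_word s t w) = 0"
  proof (rule ccontr)
    assume "\<not> ?thesis"
    then obtain a b where "flip_word s t w = drop 2 (flip_word s t v) @ [a, b]"
      by (rule transition_entry_nonzero)
    then have "w = flip_word s t (flip_word s t (drop 2 v) @ [a, b])"
      by (simp add: flip_word_eq_iff drop2_flip_word)
    also have "\<dots> = drop 2 v @ [flip s a, flip t b]"
      using v by (simp add: flip_word_append)
    finally show False using False by blast
  qed
  then show ?thesis using False transition_entry_nonzero by metis
qed

lemma flip_word_mat_admissible:
  assumes N: "1 \<le> N"
  shows "admissible N (flip_word_mat (2 * N) s t)"
  unfolding admissible_def
proof (intro ballI)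
  fix p q assume pq: "p \<in> strategies N" "q \<in> strategies N"
  let ?p = "flip_strategy N s t p" and ?q = "flip_strategy N t s q" and ?Q = "flip_word_mat (2 * N) s t"
  have eq: "?Q * transition_mat N p q * transpose_mat ?Q = transition_mat N ?p ?q"
    unfolding flip_word_mat_def transition_mat_word transpose_word_mat word_mat_mult word_mat_eq_iff
  proof (intro allI impI)
    fix v w :: "letter list"
    assume v: "length v = 2 * N" and w: "length w = 2 * N"
    show "(\<Sum>u | length u = 2 * N. (\<Sum>u' | length u' = 2 * N. of_bool (v = flip_word s t u')
        * transition_entry p q u' u) * of_bool (w = flip_word s t u)) = transition_entry ?p ?q v w"
      by (simp only: sum_flip_word_left[OF v] sum_flip_word_right[OF w] transition_entry_flip[OF v N])
  qed
  have inv: "invariant_distribution (2 ^ (2 * N)) (transition_mat N ?p ?q) (?Q *\<^sub>v \<nu>)"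
    if \<nu>: "invariant_distribution (2 ^ (2 * N)) (transition_mat N p q) \<nu>" for \<nu>
  proof -
    have "\<nu> \<in> carrier_vec (2 ^ (2 * N))"
      using \<nu> by (simp add: invariant_distribution_def probability_vec_def)
    then obtain x where x: "\<nu> = word_vec (2 * N) x"
      using ex_word_vec by blast
    have Qx: "?Q *\<^sub>v \<nu> = word_vec (2 * N) (\<lambda>v. x (flip_word s t v))"
      by (simp add: x flip_word_mat_def word_mat_mult_vec word_vec_eq_iff sum_flip_word_left
          del: sum_of_bool_mult_eq)
    have "(\<Sum>v | length v = 2 * N. transition_entry ?p ?q v w * x (flip_word s t v)) = x (flip_word s t w)"
      if "length w = 2 * N" for w
    proof -
      have "(\<Sum>v | length v = 2 * N. transition_entry ?p ?q v w * x (flip_word s t v))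
          = (\<Sum>v | length v = 2 * N. transition_entry p q (flip_word s t v) (flip_word s t w) * x (flip_word s t v))"
        using N by (simp add: transition_entry_flip)
      also have "\<dots> = x (flip_word s t w)"
        using \<nu> that unfolding x transition_mat_word invariant_distribution_word
        by (subst sum_flip_word[of "\<lambda>u. transition_entry p q u (flip_word s t w) * x u"]) simp
      finally show ?thesis .
    qed
    then show ?thesis
      using \<nu> unfolding Qx unfolding x transition_mat_word invariant_distribution_word
      by (simp add: sum_flip_word)
  qed
  show "\<exists>p'\<in>strategies N. \<exists>q'\<in>strategies N.
      ?Q * transition_mat N p q * transpose_mat ?Q = transition_mat N p' q' \<and>
      (\<forall>\<nu>. invariant_distribution (2 ^ (2 * N)) (transition_mat N p q) \<nu> \<longrightarrow>
        invariant_distribution (2 ^ (2 * N)) (transition_mat N p' q') (?Q *\<^sub>v \<nu>))"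
    using eq inv flip_strategy[OF pq(1)] flip_strategy[OF pq(2)] by blast
qed

section \<open>Kronecker products and the matrices J\<close>

text \<open>Lexicographic rank is binary notation with \<open>C\<close> as 0 and \<open>D\<close> as
  1: the quotient ranks the prefix and the remainder the suffix.\<close>

lemma words_add_nth:
  "r < 2 ^ (m + n) \<Longrightarrow> words (m + n) ! r = words m ! (r div 2 ^ n) @ words n ! (r mod 2 ^ n)"
proof (induction m arbitrary: r)
  case (Suc m)
  show ?case
  proof (cases "r < 2 ^ (m + n)")
    case True
    then have "r div 2 ^ n < 2 ^ m"
      by (simp add: less_mult_imp_div_less power_add)
    then show ?thesis using True Suc.IH[OF True] by (simp add: nth_append)
  next
    case False
    define r' where "r' = r - 2 ^ (m + n)"
    have r: "r = r' + 2 ^ m * 2 ^ n" using False by (simp add: r'_def power_add)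
    have r': "r' < 2 ^ (m + n)" using Suc.prems r by (simp add: power_add)
    then have "r' div 2 ^ n < 2 ^ m"
      by (simp add: less_mult_imp_div_less power_add)
    then show ?thesis using False r' Suc.IH[OF r'] by (simp add: nth_append r power_add)
  qed
qed simp

lemma kronecker_word_mat:
  "kronecker_mat (word_mat m K) (word_mat n L)
    = word_mat (m + n) (\<lambda>v w. K (take m v) (take m w) * L (drop m v) (drop m w))"
proof -
  have "r div 2 ^ n < 2 ^ m" "r mod 2 ^ n < 2 ^ n" if "r < 2 ^ (m + n)" for r :: nat
    using that by (auto simp: less_mult_imp_div_less power_add)
  then show ?thesis
    by (intro eq_matI) (auto simp: kronecker_mat_def word_mat_def words_add_nth power_add)
qed

text \<open>An even prefix leaves the flags in their original order at the start of the
  suffix.\<close>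

lemma kronecker_flip_word_mat:
  assumes "even m"
  shows "kronecker_mat (flip_word_mat m s t) (flip_word_mat n s t) = flip_word_mat (m + n) s t"
proof -
  have "of_bool (take m v = flip_word s t (take m w)) * of_bool (drop m v = flip_word s t (drop m w))
      = (of_bool (v = flip_word s t w) :: real)" if "length v = m + n" "length w = m + n" for v w
  proof -
    have "flip_word s t w = flip_word s t (take m w) @ flip_word s t (drop m w)"
      using flip_word_append[of s t "take m w" "drop m w"] assms that by simp
    moreover have "v = take m v @ drop m v" by simp
    ultimately have "v = flip_word s t w \<longleftrightarrow> take m v = flip_word s t (take m w) \<and> drop m v = flip_word s t (drop m w)"
      using that by (metis append_eq_append_conv length_flip_word length_take)
    then show ?thesis by simp
  qed
  then show ?thesis
    unfolding flip_word_mat_def kronecker_word_mat word_mat_eq_iff by blast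
qed

lemma words_2: "words 2 = [[C, C], [C, D], [D, C], [D, D]]"
  by (simp add: numeral_2_eq_2)

lemma less_4_cases: "i < 4 \<longleftrightarrow> i = 0 \<or> i = 1 \<or> i = 2 \<or> i = (3::nat)"
  by auto

text \<open>\<open>J1 i\<close> exchanges each position with its bitwise exclusive or with
  \<open>i - 1\<close>; the high bit flips the first player's letter and the low bit the second
  player's.\<close>

lemma J1_flip_word_mat:
  "J1 1 = flip_word_mat 2 False False" "J1 2 = flip_word_mat 2 False True"
  "J1 3 = flip_word_mat 2 True False" "J1 4 = flip_word_mat 2 True True"
  by (auto intro!: eq_matI simp: J1_def flip_word_mat_def word_mat_def mat_of_rows_list_def flip_def
      less_4_cases words_2)

lemma J_flip_word_mat:
  assumes "J1 i = flip_word_mat 2 s t"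
  shows "J (Suc n) i = flip_word_mat (2 * Suc n) s t"
proof (induction n)
  case (Suc n)
  then show ?case using kronecker_flip_word_mat[of 2 s t "2 * Suc n"] assms by simp
qed (use assms in simp)

theorem theorem2p11:
  fixes N :: nat
  assumes "N \<ge> 1"
  shows "{Q. real_orthogonal (2 ^ (2 * N)) Q \<and> admissible N Q} = {J N 1, J N 2, J N 3, J N 4}"
proof -
  have "N = Suc (N - 1)" using assms by simp
  then have J: "J N 1 = flip_word_mat (2 * N) False False" "J N 2 = flip_word_mat (2 * N) False True"
    "J N 3 = flip_word_mat (2 * N) True False" "J N 4 = flip_word_mat (2 * N) True True"
    using J1_flip_word_mat[THEN J_flip_word_mat, of "N - 1"] by metis+
  have "\<exists>s t. Q = flip_word_mat (2 * N) s t"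
    if Q: "real_orthogonal (2 ^ (2 * N)) Q" "admissible N Q" for Q
  proof -
    obtain K where K: "Q = word_mat (2 * N) K"
      using Q(1) ex_word_mat real_orthogonal_def by blast
    interpret admissible_kernel N K
      using assms Q by (intro admissible_kernel.intro) (simp_all add: K)
    show ?thesis
      using kernel_flip_word unfolding K flip_word_mat_def word_mat_eq_iff .
  qed
  then have "Q \<in> {J N 1, J N 2, J N 3, J N 4}"
    if "real_orthogonal (2 ^ (2 * N)) Q" "admissible N Q" for Q
    unfolding J using that by (metis (full_types) insert_iff)
  then show ?thesis
    unfolding J using flip_word_mat_orthogonal flip_word_mat_admissible[OF assms] by blast
qed

end
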